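(* For any $u\in\mathfrak{S}_p$ and $v\in\mathfrak{S}_q$, in $\mathfrak{S}\mathit{Sym}$ \[\mathcal{M}_u\cdot\mathcal{M}_v=\sum_{w\in\mathfrak{S}_{p+q}}\alpha^w_{u,v}\,\mathcal{M}_w,\] where $\alpha^w_{u,v}$ is the number of $\zeta\in\mathfrak{S}^{(p,q)}$ such that (i) $(u\times v)\zeta^{-1}\leq w$, and (ii) whenever $u'\in\mathfrak{S}_p$, $v'\in\mathfrak{S}_q$ with $u\leq u'$, $v\leq v'$ satisfy $(u'\times v')\zeta^{-1}\leq w$, then $u'=u$ and $v'=v$. (Equivalently, $(u,v)$ is the maximum of $\rho_\zeta^{-1}([1,w])$, where $\rho_\zeta(u,v)=(u\times v)\zeta^{-1}$ and $[1,w]$ is the interval below $w$ in the weak order.)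
   Context: For $n\geq0$, $\mathfrak{S}_n$ is the symmetric group on $[n]$ ($\mathfrak{S}_0$ has one element); $u$ is written as the word $u_1\cdots u_n$, $u_i=u(i)$; permutations multiply as functions, $(uv)(i)=u(v(i))$. $\ell(u)=\#\{i<j\mid u_i>u_j\}$; the weak order on $\mathfrak{S}_n$: $u\leq v$ iff $v=wu$ for some $w$ with $\ell(v)=\ell(w)+\ell(u)$; on $\mathfrak{S}_p\times\mathfrak{S}_q$ use the product order. For distinct integers $a_1,\dots,a_p$, $\mathrm{st}(a_1,\dots,a_p)\in\mathfrak{S}_p$ is the permutation $u$ with $u_i<u_j\iff a_i<a_j$. For $u\in\mathfrak{S}_p,v\in\mathfrak{S}_q$, $u\times v\in\mathfrak{S}_{p+q}$ has word $u_1\cdots u_p(v_1+p)\cdots(v_q+p)$; $\mathfrak{S}^{(p,q)}$ is the set of $\zeta\in\mathfrak{S}_{p+q}$ having no descent except possibly at position $p$ (Grassmannian permutations). $\mathfrak{S}\mathit{Sym}$ is the graded $\mathbb{Q}$-vector space with basis $\{\mathcal{F}_u\mid u\in\mathfrak{S}_n,n\geq0\}$, with product $\mathcal{F}_u\cdot\mathcal{F}_v=\sum_{\zeta\in\mathfrak{S}^{(p,q)}}\mathcal{F}_{(u\times v)\zeta^{-1}}$ for $u\in\mathfrak{S}_p,v\in\mathfrak{S}_q$, and coproduct $\Delta(\mathcal{F}_u)=\sum_{p=0}^n\mathcal{F}_{\mathrm{st}(u_1,\dots,u_p)}\otimes\mathcal{F}_{\mathrm{st}(u_{p+1},\dots,u_n)}$;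 it is a graded connected Hopf algebra (Malvenuto–Reutenauer). The monomial basis is $\mathcal{M}_u=\sum_{v\geq u}\mu_{\mathfrak{S}_n}(u,v)\mathcal{F}_v$, with $\mu_{\mathfrak{S}_n}$ the Möbius function of the weak order; equivalently $\mathcal{F}_u=\sum_{v\geq u}\mathcal{M}_v$. *)

theory Defs
  imports Complex_Main "HOL-Combinatorics.Permutations" "HOL-Library.Poly_Mapping"
begin

section \<open>Length and weak order\<close>

text \<open>
  An element of the symmetric group on \<open>[n]\<close> is a function \<open>u\<close> with \<open>u permutes {1..n}\<close>; its word is
  \<open>u 1, \<dots>, u n\<close> and the group product \<open>u v\<close> is \<open>u \<circ> v\<close>.  Such a function fixes everything outside
  \<open>{1..n}\<close>, hence it also permutes \<open>{1..n'}\<close> for every larger \<open>n'\<close>.  The degree \<open>n\<close> is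
  therefore passed explicitly wherever it matters.
\<close>

definition len :: "nat \<Rightarrow> (nat \<Rightarrow> nat) \<Rightarrow> nat" where
  "len n u = card {(i, j). i \<in> {1..n} \<and> j \<in> {1..n} \<and> i < j \<and> u i > u j}"

definition weak_le :: "nat \<Rightarrow> (nat \<Rightarrow> nat) \<Rightarrow> (nat \<Rightarrow> nat) \<Rightarrow> bool" where
  "weak_le n u v \<longleftrightarrow> u permutes {1..n} \<and> v permutes {1..n} \<and>
     (\<exists>w. w permutes {1..n} \<and> v = w \<circ> u \<and> len n v = len n w + len n u)"

lemma len_eq_0_imp_id:
  assumes w: "w permutes {1..n}" and l: "len n w = 0"
  shows "w = id"
proof (rule permutes_natset_ge[OF w], rule ballI)
  have fin: "finite {(i, j). i \<in> {1..n} \<and> j \<in> {1..n} \<and> i < j \<and> w i > w j}"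
    by (rule finite_subset[of _ "{1..n} \<times> {1..n}"]) auto
  have less: "w i < w j" if "i \<in> {1..n}" "j \<in> {1..n}" "i < j" for i j
  proof -
    have "\<not> w i > w j"
      using l fin that unfolding len_def by auto
    moreover have "w i \<noteq> w j"
      using permutes_inj[OF w] that by (auto dest: injD)
    ultimately show ?thesis by simp
  qed
  fix i
  assume "i \<in> {1..n}"
  then show "i \<le> w i"
  proof (induction i)
    case (Suc i)
    show ?case
    proof (cases "i = 0")
      case True
      then show ?thesis using permutes_in_image[OF w, of "Suc i"] Suc.prems by auto
    next
      case False
      then show ?thesis using Suc less[of i "Suc i"] by auto
    qed
  qed simp
qed

lemma weak_le_len_less:
  assumes "weak_le n z v" "z \<noteq> v"
  shows "len n z < len n v"
proof -
  obtain w where w: "w permutes {1..n}" "v = w \<circ> z" "len n v = len n w + len n z"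
    using assms(1) unfolding weak_le_def by blast
  have "len n w \<noteq> 0" using len_eq_0_imp_id[OF w(1)] w(2) assms(2) by auto
  then show ?thesis using w(3) by simp
qed

function moebius :: "nat \<Rightarrow> (nat \<Rightarrow> nat) \<Rightarrow> (nat \<Rightarrow> nat) \<Rightarrow> int" where
  "moebius n u v =
     (if \<not> weak_le n u v then 0
      else if u = v then 1
      else - (\<Sum>z \<in> {z. weak_le n u z \<and> weak_le n z v \<and> z \<noteq> v}. moebius n u z))"
  by pat_completeness auto
termination
  by (relation "measure (\<lambda>(n, u, v). len n v)") (auto intro: weak_le_len_less)

declare moebius.simps [simp del]


section \<open>Products of permutations and Grassmannian permutations\<close>

definition perm_times :: "nat \<Rightarrow> (nat \<Rightarrow> nat) \<Rightarrow> (nat \<Rightarrow> nat) \<Rightarrow> nat \<Rightarrow> nat" where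
  "perm_times p u v = (\<lambda>i. if i \<le> p then u i else v (i - p) + p)"

definition grassmannian :: "nat \<Rightarrow> nat \<Rightarrow> (nat \<Rightarrow> nat) set" where
  "grassmannian p q = {\<zeta>. \<zeta> permutes {1..p + q} \<and>
     (\<forall>i. 1 \<le> i \<and> i < p + q \<and> \<zeta> i > \<zeta> (i + 1) \<longrightarrow> i = p)}"

definition rho :: "nat \<Rightarrow> (nat \<Rightarrow> nat) \<Rightarrow> (nat \<Rightarrow> nat) \<Rightarrow> (nat \<Rightarrow> nat) \<Rightarrow> nat \<Rightarrow> nat" where
  "rho p \<zeta> u v = perm_times p u v \<circ> inv \<zeta>"


section \<open>The algebra of Malvenuto and Reutenauer\<close>

text \<open>The disjoint union of all symmetric groups: permutations together with their degree.\<close>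

typedef gperm = "{(n :: nat, u :: nat \<Rightarrow> nat). u permutes {1..n}}"
  by (rule exI[of _ "(0, id)"]) (auto simp: permutes_id)

definition deg :: "gperm \<Rightarrow> nat" where
  "deg a = fst (Rep_gperm a)"

definition perm :: "gperm \<Rightarrow> nat \<Rightarrow> nat" where
  "perm a = snd (Rep_gperm a)"

type_synonym ssym = "gperm \<Rightarrow>\<^sub>0 rat"

definition ssym_scale :: "rat \<Rightarrow> ssym \<Rightarrow> ssym"  (infixr "*\<^sub>Q" 75) where
  "c *\<^sub>Q x = Poly_Mapping.map ((*) c) x"

text \<open>\<open>\<F> n u\<close> and \<open>\<M> n u\<close> are meaningful only if \<open>u permutes {1..n}\<close>.\<close>

definition fund :: "nat \<Rightarrow> (nat \<Rightarrow> nat) \<Rightarrow> ssym"  ("\<F>") where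
  "\<F> n u = Poly_Mapping.single (Abs_gperm (n, u)) 1"

definition mon :: "nat \<Rightarrow> (nat \<Rightarrow> nat) \<Rightarrow> ssym"  ("\<M>") where
  "\<M> n u = (\<Sum>v \<in> {v. weak_le n u v}. of_int (moebius n u v) *\<^sub>Q \<F> n v)"

definition fund_prod :: "gperm \<Rightarrow> gperm \<Rightarrow> ssym" where
  "fund_prod a b =
     (\<Sum>\<zeta> \<in> grassmannian (deg a) (deg b).
        \<F> (deg a + deg b) (rho (deg a) \<zeta> (perm a) (perm b)))"

text \<open>
  The bilinear extension of \<^const>\<open>fund_prod\<close>.  The \<open>times\<close> instance of finitely supported functions is
  convolution over a monoid of indices and is not the product wanted here.
\<close>

definition ssym_mult :: "ssym \<Rightarrow> ssym \<Rightarrow> ssym"  (infixl "\<star>" 70) where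
  "x \<star> y = (\<Sum>a \<in> Poly_Mapping.keys x. \<Sum>b \<in> Poly_Mapping.keys y.
     (Poly_Mapping.lookup x a * Poly_Mapping.lookup y b) *\<^sub>Q fund_prod a b)"

lemma lookup_ssym_scale [simp]:
  "Poly_Mapping.lookup (c *\<^sub>Q x) a = c * Poly_Mapping.lookup x a"
  by (simp add: ssym_scale_def Poly_Mapping.map.rep_eq when_def)

interpretation ssym: vector_space ssym_scale
  by unfold_locales
    (auto intro!: poly_mapping_eqI simp: lookup_add algebra_simps)

lemma fund_mult_fund:
  assumes "u permutes {1..p}" "v permutes {1..q}"
  shows "\<F> p u \<star> \<F> q v =
    (\<Sum>\<zeta> \<in> grassmannian p q. \<F> (p + q) (perm_times p u v \<circ> inv \<zeta>))"
  using assms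
  by (simp add: ssym_mult_def fund_def[of p] fund_def[of q] fund_prod_def rho_def deg_def perm_def Abs_gperm_inverse)


section \<open>Structure constants of the monomial basis\<close>

definition alpha ::
  "nat \<Rightarrow> nat \<Rightarrow> (nat \<Rightarrow> nat) \<Rightarrow> (nat \<Rightarrow> nat) \<Rightarrow> (nat \<Rightarrow> nat) \<Rightarrow> nat" where
  "alpha p q u v w = card {\<zeta> \<in> grassmannian p q.
     weak_le (p + q) (rho p \<zeta> u v) w \<and>
     (\<forall>u' v'. u' permutes {1..p} \<and> v' permutes {1..q} \<and> weak_le p u u' \<and> weak_le q v v' \<and>
        weak_le (p + q) (rho p \<zeta> u' v') w \<longrightarrow> u' = u \<and> v' = v)}"

end

theory Submission
  imports Defs
begin

text \<open>
  The weak order is inclusion of inversion sets.  The inversions of \<open>(u \<times> v)\<zeta>\<^sup>-\<^sup>1\<close> are those of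
  \<open>\<zeta>\<^sup>-\<^sup>1\<close> together with the \<open>\<zeta>\<close>-images of the inversions of the two factors, because \<open>\<zeta>\<close> increases on
  both blocks.  Hence \<open>\<rho>\<^sub>\<zeta>(u, v) \<le> w\<close> holds iff \<open>\<zeta>\<^sup>-\<^sup>1 \<le> w\<close> and \<open>u \<le> a\<close> and \<open>v \<le> b\<close>, where \<open>a\<close> and
  \<open>b\<close> standardize the two blocks of the word \<open>w\<zeta>\<close>; so \<open>(a, b)\<close> is the maximum of the preimage of
  \<open>[1, w]\<close> and \<open>\<alpha>\<close> counts the \<open>\<zeta>\<close> with \<open>\<zeta>\<^sup>-\<^sup>1 \<le> w\<close> and \<open>(a, b) = (u, v)\<close>.  Expanding
  \<open>\<F>\<^sub>u\<^sub>' \<cdot> \<F>\<^sub>v\<^sub>'\<close> in the monomial basis and inverting in both factors, each \<open>\<zeta>\<close>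
  with \<open>\<zeta>\<^sup>-\<^sup>1 \<le> w\<close> contributes
  \<open>\<Sum>\<^bsub>u \<le> u' \<le> a\<^esub> \<mu>(u, u') \<cdot> \<Sum>\<^bsub>v \<le> v' \<le> b\<^esub> \<mu>(v, v') = [u = a][v = b]\<close>.
\<close>

section \<open>Weak order and inversion sets\<close>

definition inversions :: "nat \<Rightarrow> (nat \<Rightarrow> nat) \<Rightarrow> (nat \<times> nat) set" where
  "inversions n u = {(i, j). i \<in> {1..n} \<and> j \<in> {1..n} \<and> i < j \<and> u i > u j}"

lemma len_eq_card_inversions: "len n u = card (inversions n u)"
  by (simp add: len_def inversions_def)

lemma finite_inversions [simp]: "finite (inversions n u)"
  by (rule finite_subset[of _ "{1..n} \<times> {1..n}"]) (auto simp: inversions_def)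

text \<open>A pair of values is inverted by \<open>v \<circ> inv u\<close> exactly when
  \<open>u\<close> and \<open>v\<close> order the corresponding two positions oppositely, so these
  inversions are in bijection with the symmetric difference of the two inversion sets.\<close>

lemma len_comp_inv:
  assumes u: "u permutes {1..n}" and v: "v permutes {1..n}"
  shows "len n (v \<circ> inv u) =
    card (inversions n v - inversions n u) + card (inversions n u - inversions n v)"
proof -
  let ?A = "inversions n v - inversions n u" and ?B = "inversions n u - inversions n v"
  \<comment> \<open>The two values of \<open>u\<close> are sorted because an inversion of
    \<open>u\<close> carries them in decreasing order.\<close>
  let ?g = "\<lambda>(i, j). (min (u i) (u j), max (u i) (u j))"
  have injs: "u i = u j \<longleftrightarrow> i = j" "v i = v j \<longleftrightarrow> i = j" for i j
    using permutes_inj[OF u] permutes_inj[OF v] by (simp_all add: inj_eq)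
  have inn: "u i \<in> {1..n} \<longleftrightarrow> i \<in> {1..n}" for i
    by (rule permutes_in_image[OF u])
  have iu: "inv u (u i) = i" "u (inv u i) = i" for i
    using permutes_inverses[OF u] by auto
  have inj: "inj_on ?g (?A \<union> ?B)"
    by (rule inj_onI) (auto simp: inversions_def min_def max_def injs split: if_splits)
  have "?g ` (?A \<union> ?B) = inversions n (v \<circ> inv u)"
  proof
    show "?g ` (?A \<union> ?B) \<subseteq> inversions n (v \<circ> inv u)"
    proof (rule image_subsetI)
      fix x assume mem: "x \<in> ?A \<union> ?B"
      obtain i j where x: "x = (i, j)" by (cases x)
      from mem have "i \<noteq> j" "i \<in> {1..n}" "j \<in> {1..n}"
        by (auto simp: x inversions_def)
      moreover from this have "u i \<noteq> u j" "v i \<noteq> v j" "u i \<in> {1..n}" "u j \<in> {1..n}"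
        using injs inn by auto
      ultimately show "?g x \<in> inversions n (v \<circ> inv u)"
        using mem by (auto simp: x inversions_def min_def max_def iu)
    qed
    show "inversions n (v \<circ> inv u) \<subseteq> ?g ` (?A \<union> ?B)"
    proof clarify
      fix x y
      assume xy: "(x, y) \<in> inversions n (v \<circ> inv u)"
      define i j where "i = inv u x" and "j = inv u y"
      have x: "x = u i" and y: "y = u j"
        by (simp_all add: i_def j_def iu)
      have ij: "i \<in> {1..n}" "j \<in> {1..n}" "u i < u j" "v j < v i"
        using xy inn by (auto simp: inversions_def x y iu)
      then have "i \<noteq> j" by auto
      then consider "i < j" | "j < i" by linarith
      then show "(x, y) \<in> ?g ` (?A \<union> ?B)"
      proof cases
        case 1
        then have "(i, j) \<in> ?A \<union> ?B" using ij by (auto simp: inversions_def)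
        moreover have "(x, y) = ?g (i, j)" using ij by (simp add: x y)
        ultimately show ?thesis by (rule rev_image_eqI)
      next
        case 2
        then have "(j, i) \<in> ?A \<union> ?B" using ij by (auto simp: inversions_def)
        moreover have "(x, y) = ?g (j, i)" using ij by (simp add: x y)
        ultimately show ?thesis by (rule rev_image_eqI)
      qed
    qed
  qed
  then have "len n (v \<circ> inv u) = card (?A \<union> ?B)"
    using card_image[OF inj] by (simp add: len_eq_card_inversions)
  also have "\<dots> = card ?A + card ?B"
    by (rule card_Un_disjoint) auto
  finally show ?thesis .
qed

text \<open>The factor \<open>w\<close> in the weak order is forced to be
  \<open>v \<circ> inv u\<close>. By \<open>len_comp_inv\<close>, cancelling in the length equation
  leaves twice the number of inversions of \<open>u\<close> that \<open>v\<close> lacks, which must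
  be zero.\<close>

lemma weak_le_iff_inversions:
  "weak_le n u v \<longleftrightarrow>
    u permutes {1..n} \<and> v permutes {1..n} \<and> inversions n u \<subseteq> inversions n v"
proof (cases "u permutes {1..n} \<and> v permutes {1..n}")
  case True
  then have u: "u permutes {1..n}" and v: "v permutes {1..n}" by auto
  let ?I = "inversions n"
  have "w = v \<circ> inv u" if "v = w \<circ> u" for w
    using that permutes_inverses[OF u] by (auto simp: fun_eq_iff)
  moreover have "v = (v \<circ> inv u) \<circ> u"
    using permutes_inverses[OF u] by (auto simp: fun_eq_iff)
  moreover have "(v \<circ> inv u) permutes {1..n}"
    using u v by (intro permutes_compose permutes_inv)
  ultimately have "weak_le n u v \<longleftrightarrow> len n v = len n (v \<circ> inv u) + len n u"
    unfolding weak_le_def using u v by metis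
  also have "\<dots> \<longleftrightarrow> card (?I v) = card (?I v - ?I u) + card (?I u - ?I v) + card (?I u)"
    by (simp only: len_comp_inv[OF u v]) (simp only: len_eq_card_inversions)
  also have "\<dots> \<longleftrightarrow> card (?I u - ?I v) = 0"
  proof -
    have "card (?I v) = card (?I v - ?I u) + card (?I v \<inter> ?I u)"
      by (metis card_Int_Diff finite_inversions add.commute)
    moreover have "card (?I u) = card (?I u - ?I v) + card (?I v \<inter> ?I u)"
      by (metis card_Int_Diff finite_inversions add.commute inf_commute)
    ultimately show ?thesis by linarith
  qed
  also have "\<dots> \<longleftrightarrow> ?I u \<subseteq> ?I v"
    by simp
  finally show ?thesis using u v by simp
qed (auto simp: weak_le_def)

lemma weak_le_iff:
  assumes "u permutes {1..n}" "v permutes {1..n}"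
  shows "weak_le n u v \<longleftrightarrow>
    (\<forall>i \<in> {1..n}. \<forall>j \<in> {1..n}. i < j \<and> u i > u j \<longrightarrow> v i > v j)"
  using assms unfolding weak_le_iff_inversions inversions_def by blast

lemma weak_le_refl: "u permutes {1..n} \<Longrightarrow> weak_le n u u"
  by (simp add: weak_le_iff_inversions)

lemma weak_le_trans: "weak_le n u v \<Longrightarrow> weak_le n v w \<Longrightarrow> weak_le n u w"
  by (auto simp: weak_le_iff_inversions)

lemma weak_le_antisym:
  assumes "weak_le n u v" "weak_le n v u"
  shows "u = v"
  using assms weak_le_len_less[of n u v] weak_le_len_less[of n v u] by fastforce

lemma finite_weak_le [simp]: "finite {v. weak_le n u v}"
  by (rule finite_subset[of _ "{v. v permutes {1..n}}"])
    (auto simp: weak_le_def finite_permutations)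


section \<open>Moebius inversion\<close>

text \<open>For \<open>u\<close> strictly below \<open>a\<close> this is the defining recursion of
  \<open>moebius\<close>. The upper bound is an indicator, so the range of summation depends on
  \<open>u\<close> alone; this allows sums to be interchanged and factored later.\<close>

lemma sum_moebius:
  assumes "u permutes {1..n}" and a: "a permutes {1..n}"
  shows "(\<Sum>z \<in> {z. weak_le n u z}. moebius n u z * of_bool (weak_le n z a)) = of_bool (u = a)"
    (is "?S = _")
proof -
  let ?I = "{z. weak_le n u z \<and> weak_le n z a}"
  have fin: "finite ?I"
    by (rule finite_subset[of _ "{z. weak_le n u z}"]) auto
  have "?S = (\<Sum>z \<in> ?I. moebius n u z)"
    by (rule sum.mono_neutral_cong_right) auto
  also have "\<dots> = of_bool (u = a)"
  proof (cases "weak_le n u a")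
    case True
    have "?I = insert a {z. weak_le n u z \<and> weak_le n z a \<and> z \<noteq> a}"
      using True a by (auto intro: weak_le_refl)
    moreover have "finite {z. weak_le n u z \<and> weak_le n z a \<and> z \<noteq> a}"
      by (rule finite_subset[OF _ fin]) auto
    ultimately have "(\<Sum>z \<in> ?I. moebius n u z) = moebius n u a +
        (\<Sum>z \<in> {z. weak_le n u z \<and> weak_le n z a \<and> z \<noteq> a}. moebius n u z)"
      by simp
    \<comment> \<open>Covers the case \<open>u = a\<close>, where \<open>moebius\<close> is 1
      without recursion: nothing but \<open>a\<close> lies between \<open>a\<close> and
      itself.\<close>
    moreover have "(\<Sum>z \<in> {z. weak_le n a z \<and> weak_le n z a \<and> z \<noteq> a}. moebius n a z) = 0"
      by (rule sum.neutral) (auto dest: weak_le_antisym)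
    ultimately show ?thesis
      using True by (auto simp: moebius.simps[of n u a])
  next
    case False
    then have I: "?I = {}" and "u \<noteq> a"
      using weak_le_trans weak_le_refl[OF a] by blast+
    then show ?thesis unfolding I by simp
  qed
  finally show ?thesis .
qed

lemma moebius_self: "u permutes {1..n} \<Longrightarrow> moebius n u u = 1"
  by (simp add: moebius.simps weak_le_refl)

text \<open>Direct substitution of \<open>mon_def\<close> would need the Moebius identity summed
  over the first argument, whereas \<open>sum_moebius\<close> sums over the second. Instead, the
  right-hand side \<open>G\<close> and \<open>\<F>\<close> are shown to have the same Moebius
  transform \<open>\<M> n u\<close>; they agree strictly above \<open>u\<close> by induction, and
  the coefficient at \<open>u\<close> is 1, so they agree at \<open>u\<close>.\<close>

lemma fund_eq_sum_mon:
  assumes "u permutes {1..n}"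
  shows "\<F> n u = (\<Sum>v \<in> {v. weak_le n u v}. \<M> n v)"
  using assms
proof (induction "card {v. weak_le n u v}" arbitrary: u rule: less_induct)
  case less
  note u = less.prems
  define G where "G y = (\<Sum>v \<in> {v. weak_le n y v}. \<M> n v)" for y
  let ?U = "{y. weak_le n u y}"
  let ?m = "\<lambda>y. (of_int (moebius n u y) :: rat)"
  \<comment> \<open>Extends every inner sum to the common range \<open>?U\<close>, so that the
    double sum can be interchanged.\<close>
  have G: "G y = (\<Sum>v \<in> ?U. of_bool (weak_le n y v) *\<^sub>Q \<M> n v)" if "y \<in> ?U" for y
    unfolding G_def using that
    by (intro sum.mono_neutral_cong_left) (auto dest: weak_le_trans)
  \<comment> \<open>The upper set of \<open>y\<close> lies in that of \<open>u\<close> and misses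
    \<open>u\<close> itself, so the induction measure drops.\<close>
  have IH: "G y = \<F> n y" if "y \<in> ?U - {u}" for y
  proof -
    have "{v. weak_le n y v} \<subset> ?U"
      using that u weak_le_refl[OF u] weak_le_trans weak_le_antisym by blast
    then have "card {v. weak_le n y v} < card ?U"
      by (rule psubset_card_mono[rotated]) simp
    moreover have "y permutes {1..n}" using that by (simp add: weak_le_def)
    ultimately show ?thesis using less.hyps by (simp add: G_def)
  qed
  have "(\<Sum>y \<in> ?U. ?m y *\<^sub>Q G y) =
      (\<Sum>y \<in> ?U. \<Sum>v \<in> ?U. (?m y * of_bool (weak_le n y v)) *\<^sub>Q \<M> n v)"
    by (intro sum.cong refl) (simp add: G ssym.scale_sum_right)
  also have "\<dots> = (\<Sum>v \<in> ?U. (\<Sum>y \<in> ?U. ?m y * of_bool (weak_le n y v)) *\<^sub>Q \<M> n v)"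
    unfolding ssym.scale_sum_left by (rule sum.swap)
  also have "\<dots> = (\<Sum>v \<in> ?U. of_bool (v = u) *\<^sub>Q \<M> n v)"
  proof (intro sum.cong refl)
    fix v assume "v \<in> ?U"
    then have "v permutes {1..n}" by (simp add: weak_le_def)
    from arg_cong[OF sum_moebius[OF u this], of "of_int :: int \<Rightarrow> rat"]
    show "(\<Sum>y \<in> ?U. ?m y * of_bool (weak_le n y v)) *\<^sub>Q \<M> n v = of_bool (v = u) *\<^sub>Q \<M> n v"
      by (simp add: eq_commute[of u v])
  qed
  also have "\<dots> = (\<Sum>v \<in> ?U. if v = u then \<M> n v else 0)"
    by (intro sum.cong) auto
  also have "\<dots> = \<M> n u"
    using weak_le_refl[OF u] by simp
  finally have "(\<Sum>y \<in> ?U. ?m y *\<^sub>Q G y) = (\<Sum>y \<in> ?U. ?m y *\<^sub>Q \<F> n y)"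
    by (simp add: mon_def)
  moreover have "(\<Sum>y \<in> ?U. ?m y *\<^sub>Q H y) = H u + (\<Sum>y \<in> ?U - {u}. ?m y *\<^sub>Q H y)" for H
    by (subst sum.remove[of _ u]) (use u in \<open>auto simp: weak_le_refl moebius_self\<close>)
  ultimately have "G u = \<F> n u"
    using IH by simp
  then show ?case by (simp add: G_def)
qed


section \<open>Standardization\<close>

definition standardize :: "nat \<Rightarrow> (nat \<Rightarrow> nat) \<Rightarrow> nat \<Rightarrow> nat" where
  "standardize n f i = (if i \<in> {1..n} then card {k \<in> {1..n}. f k \<le> f i} else i)"

lemma standardize_less_iff:
  assumes "i \<in> {1..n}" "j \<in> {1..n}"
  shows "standardize n f i < standardize n f j \<longleftrightarrow> f i < f j"
proof
  assume "f i < f j"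
  then have "{k \<in> {1..n}. f k \<le> f i} \<subset> {k \<in> {1..n}. f k \<le> f j}"
    using assms by (auto simp: psubset_eq set_eq_iff intro!: exI[of _ j])
  then show "standardize n f i < standardize n f j"
    using assms by (simp add: standardize_def psubset_card_mono)
next
  assume less: "standardize n f i < standardize n f j"
  show "f i < f j"
  proof (rule ccontr)
    assume "\<not> f i < f j"
    then have "card {k \<in> {1..n}. f k \<le> f j} \<le> card {k \<in> {1..n}. f k \<le> f i}"
      by (intro card_mono) auto
    with less show False using assms by (simp add: standardize_def)
  qed
qed

lemma standardize_permutes:
  assumes "inj_on f {1..n}"
  shows "standardize n f permutes {1..n}"
proof -
  have "inj_on (standardize n f) {1..n}"
  proof (rule inj_onI)
    fix i j assume ij: "i \<in> {1..n}" "j \<in> {1..n}" "standardize n f i = standardize n f j"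
    then have "\<not> f i < f j" "\<not> f j < f i"
      using standardize_less_iff[of i n j f] standardize_less_iff[of j n i f] by auto
    then show "i = j" using assms ij by (auto dest: inj_onD)
  qed
  moreover have "standardize n f ` {1..n} \<subseteq> {1..n}"
  proof clarify
    fix i assume i: "i \<in> {1..n}"
    have "card {k \<in> {1..n}. f k \<le> f i} \<le> card {1..n}"
      by (rule card_mono) auto
    moreover have "card {k \<in> {1..n}. f k \<le> f i} > 0"
      using i by (auto simp: card_gt_0_iff)
    ultimately show "standardize n f i \<in> {1..n}"
      using i by (simp add: standardize_def)
  qed
  ultimately have "bij_betw (standardize n f) {1..n} {1..n}"
    by (simp add: bij_betw_def endo_inj_surj)
  then show ?thesis
    by (rule bij_imp_permutes) (simp add: standardize_def del: atLeastAtMost_iff)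
qed

text \<open>Inversions depend only on the relative order of the letters, which
  \<open>standardize\<close> preserves, so the comparison can be made on \<open>f\<close>
  itself.\<close>

lemma weak_le_standardize_iff:
  assumes "u permutes {1..n}" "inj_on f {1..n}"
  shows "weak_le n u (standardize n f) \<longleftrightarrow>
    (\<forall>i \<in> {1..n}. \<forall>j \<in> {1..n}. i < j \<and> u i > u j \<longrightarrow> f i > f j)"
  unfolding weak_le_iff[OF assms(1) standardize_permutes[OF assms(2)]]
  by (intro ball_cong refl) (simp only: standardize_less_iff)


section \<open>Grassmannian permutations\<close>

lemma strict_mono_on_Icc:
  fixes f :: "nat \<Rightarrow> nat"
  assumes step: "\<And>k. a \<le> k \<Longrightarrow> k < b \<Longrightarrow> f k < f (Suc k)"
  shows "strict_mono_on {a..b} f"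
proof (rule strict_mono_onI)
  fix i j assume i: "i \<in> {a..b}" and "j \<in> {a..b}" and "i < j"
  have "Suc i \<le> j" using \<open>i < j\<close> by simp
  then show "f i < f j" using \<open>j \<in> {a..b}\<close>
  proof (induction j rule: dec_induct)
    case base
    then show ?case using step[of i] i by auto
  next
    case (step k)
    then show ?case using i assms[of k] by auto
  qed
qed

lemma grassmannian_permutes: "\<zeta> \<in> grassmannian p q \<Longrightarrow> \<zeta> permutes {1..p + q}"
  by (simp add: grassmannian_def)

lemma finite_grassmannian [simp]: "finite (grassmannian p q)"
  using finite_permutations[of "{1..p + q}"]
  by (rule rev_finite_subset) (auto dest: grassmannian_permutes simp del: One_nat_def)

text \<open>The only permitted descent is the step from position \<open>p\<close> to
  \<open>p + 1\<close>, which is internal to neither block.\<close>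

lemma grassmannian_strict_mono_on:
  assumes "\<zeta> \<in> grassmannian p q"
  shows "strict_mono_on {1..p} \<zeta>" and "strict_mono_on {p + 1..p + q} \<zeta>"
proof -
  have step: "\<zeta> k < \<zeta> (Suc k)" if "1 \<le> k" "k < p + q" "k \<noteq> p" for k
  proof -
    have "\<not> \<zeta> k > \<zeta> (Suc k)"
      using assms that unfolding grassmannian_def Suc_eq_plus1 by blast
    moreover have "\<zeta> k \<noteq> \<zeta> (Suc k)"
      by (simp add: inj_eq[OF permutes_inj[OF grassmannian_permutes[OF assms]]])
    ultimately show ?thesis by simp
  qed
  show "strict_mono_on {1..p} \<zeta>"
    by (intro strict_mono_on_Icc step) linarith+
  show "strict_mono_on {p + 1..p + q} \<zeta>"
    by (intro strict_mono_on_Icc step) linarith+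
qed

section \<open>The permutations \<open>perm_times p u v\<close> and
  \<open>rho p \<zeta> u v\<close>\<close>

lemma perm_times_permutes:
  assumes u: "u permutes {1..p}" and v: "v permutes {1..q}"
  shows "perm_times p u v permutes {1..p + q}"
proof -
  have left: "perm_times p u v i = u i" "u i \<in> {1..p}" if "i \<in> {1..p + q}" "i \<le> p" for i
    using that permutes_in_image[OF u, of i] by (auto simp: perm_times_def)
  have right: "perm_times p u v i = v (i - p) + p" "v (i - p) \<in> {1..q}"
    if "i \<in> {1..p + q}" "\<not> i \<le> p" for i
  proof -
    have "i - p \<in> {1..q}" using that by auto
    then show "v (i - p) \<in> {1..q}" using permutes_in_image[OF v] by blast
  qed (simp add: perm_times_def that)
  have "inj_on (perm_times p u v) {1..p + q}"
  proof (rule inj_onI)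
    fix i j
    assume ij: "i \<in> {1..p + q}" "j \<in> {1..p + q}" "perm_times p u v i = perm_times p u v j"
    \<comment> \<open>Values at most \<open>p\<close> occur exactly in the left block, so equal
      values come from the same block.\<close>
    have "perm_times p u v k \<le> p \<longleftrightarrow> k \<le> p" if "k \<in> {1..p + q}" for k
      using left[OF that] right[OF that] by (cases "k \<le> p") simp_all
    then have block: "i \<le> p \<longleftrightarrow> j \<le> p"
      using ij by metis
    show "i = j"
    proof (cases "i \<le> p")
      case True
      then have "u i = u j" using left[of i] left[of j] ij block by simp
      then show ?thesis by (rule injD[OF permutes_inj[OF u]])
    next
      case False
      then have "v (i - p) = v (j - p)" using right[of i] right[of j] ij block by simp
      then have "i - p = j - p" by (rule injD[OF permutes_inj[OF v]])
      then show ?thesis using False block by simp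
    qed
  qed
  moreover have "perm_times p u v ` {1..p + q} \<subseteq> {1..p + q}"
  proof clarify
    fix i assume "i \<in> {1..p + q}"
    then show "perm_times p u v i \<in> {1..p + q}"
      using left[of i] right[of i] by (cases "i \<le> p") auto
  qed
  ultimately have "bij_betw (perm_times p u v) {1..p + q} {1..p + q}"
    by (simp add: bij_betw_def endo_inj_surj)
  then show ?thesis
  proof (rule bij_imp_permutes)
    \<comment> \<open>Position 0 falls into the branch of \<open>u\<close>, positions beyond
      \<open>p + q\<close> into that of \<open>v\<close>; both factors fix the points in
      question.\<close>
    fix i assume i: "i \<notin> {1..p + q}"
    then have "i \<notin> {1..p}" "i - p \<notin> {1..q}" by auto
    then have "u i = i" "v (i - p) = i - p"
      using permutes_not_in[OF u] permutes_not_in[OF v] by blast+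
    then show "perm_times p u v i = i"
      by (simp add: perm_times_def)
  qed
qed

lemma rho_permutes:
  assumes "\<zeta> \<in> grassmannian p q" "u permutes {1..p}" "v permutes {1..q}"
  shows "rho p \<zeta> u v permutes {1..p + q}"
  unfolding rho_def
  using assms by (intro permutes_compose permutes_inv perm_times_permutes grassmannian_permutes)

text \<open>Substituting \<open>i = \<zeta> x\<close> and \<open>j = \<zeta> y\<close> in
  \<open>weak_le_iff\<close> removes the inverse, so that \<open>r\<close> is evaluated at positions
  whose block is known.\<close>

lemma weak_le_comp_inv_iff:
  assumes r: "r permutes {1..n}" and z: "\<zeta> permutes {1..n}" and w: "w permutes {1..n}"
  shows "weak_le n (r \<circ> inv \<zeta>) w \<longleftrightarrow>
    (\<forall>x \<in> {1..n}. \<forall>y \<in> {1..n}. \<zeta> x < \<zeta> y \<and> r x > r y \<longrightarrow> w (\<zeta> x) > w (\<zeta> y))"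
proof -
  have rz: "(r \<circ> inv \<zeta>) permutes {1..n}"
    using r z by (intro permutes_compose permutes_inv)
  have "weak_le n (r \<circ> inv \<zeta>) w \<longleftrightarrow> (\<forall>i \<in> {1..n}. \<forall>j \<in> {1..n}.
      i < j \<and> r (inv \<zeta> i) > r (inv \<zeta> j) \<longrightarrow> w i > w j)"
    using weak_le_iff[OF rz w] by simp
  also have "\<dots> \<longleftrightarrow> (\<forall>i \<in> \<zeta> ` {1..n}. \<forall>j \<in> \<zeta> ` {1..n}.
      i < j \<and> r (inv \<zeta> i) > r (inv \<zeta> j) \<longrightarrow> w i > w j)"
    by (simp only: permutes_image[OF z])
  also have "\<dots> \<longleftrightarrow> (\<forall>x \<in> {1..n}. \<forall>y \<in> {1..n}.
      \<zeta> x < \<zeta> y \<and> r x > r y \<longrightarrow> w (\<zeta> x) > w (\<zeta> y))"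
    by (simp only: ball_simps(9) permutes_inverses(2)[OF z])
  finally show ?thesis .
qed

text \<open>This is \<open>\<zeta>\<^sup>-\<^sup>1 \<le> w\<close>, since all inversions of \<open>\<zeta>\<^sup>-\<^sup>1\<close> come from pairs in different blocks.\<close>

definition inv_below :: "nat \<Rightarrow> nat \<Rightarrow> (nat \<Rightarrow> nat) \<Rightarrow> (nat \<Rightarrow> nat) \<Rightarrow> bool" where
  "inv_below p q \<zeta> w \<longleftrightarrow>
    (\<forall>i \<in> {1..p}. \<forall>j \<in> {1..q}. \<zeta> (j + p) < \<zeta> i \<longrightarrow> w (\<zeta> (j + p)) > w (\<zeta> i))"

definition left_block :: "nat \<Rightarrow> (nat \<Rightarrow> nat) \<Rightarrow> (nat \<Rightarrow> nat) \<Rightarrow> nat \<Rightarrow> nat" where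
  "left_block p \<zeta> w = standardize p (\<lambda>i. w (\<zeta> i))"

definition right_block :: "nat \<Rightarrow> nat \<Rightarrow> (nat \<Rightarrow> nat) \<Rightarrow> (nat \<Rightarrow> nat) \<Rightarrow> nat \<Rightarrow> nat" where
  "right_block p q \<zeta> w = standardize q (\<lambda>i. w (\<zeta> (i + p)))"

lemma inj_on_blocks:
  fixes \<zeta> w :: "nat \<Rightarrow> nat"
  assumes "\<zeta> permutes {1..n}" "w permutes {1..n}"
  shows "inj_on (\<lambda>i. w (\<zeta> i)) A" "inj_on (\<lambda>i. w (\<zeta> (i + p))) A"
  by (simp_all add: inj_on_def inj_eq[OF permutes_inj[OF assms(1)]]
      inj_eq[OF permutes_inj[OF assms(2)]])

lemma blocks_permute:
  assumes "\<zeta> \<in> grassmannian p q" "w permutes {1..p + q}"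
  shows "left_block p \<zeta> w permutes {1..p}" "right_block p q \<zeta> w permutes {1..q}"
  unfolding left_block_def right_block_def
  by (intro standardize_permutes inj_on_blocks[OF grassmannian_permutes[OF assms(1)] assms(2)])+

text \<open>Applied to both variables, this breaks a condition on pairs of positions into four, one
  for each ordered pair of blocks.\<close>

lemma ball_blocks:
  fixes p q :: nat
  shows "(\<forall>x \<in> {1..p + q}. P x) \<longleftrightarrow> (\<forall>i \<in> {1..p}. P i) \<and> (\<forall>j \<in> {1..q}. P (j + p))"
    (is "?L \<longleftrightarrow> ?R")
proof
  assume R: ?R
  show ?L
  proof
    fix x assume "x \<in> {1..p + q}"
    then have "x \<in> {1..p} \<or> x - p \<in> {1..q} \<and> x = (x - p) + p" by auto
    then show "P x" using R by metis
  qed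
qed auto

text \<open>The four kinds of pairs decouple: mixed pairs constrain only \<open>\<zeta>\<close> and
  \<open>w\<close>, while pairs inside one block involve only \<open>u\<close> or only
  \<open>v\<close>, because \<open>\<zeta>\<close> preserves the order of positions there.\<close>

lemma weak_le_rho_iff:
  assumes z: "\<zeta> \<in> grassmannian p q" and w: "w permutes {1..p + q}"
    and u: "u permutes {1..p}" and v: "v permutes {1..q}"
  shows "weak_le (p + q) (rho p \<zeta> u v) w \<longleftrightarrow>
    inv_below p q \<zeta> w \<and> weak_le p u (left_block p \<zeta> w) \<and> weak_le q v (right_block p q \<zeta> w)"
proof -
  let ?r = "perm_times p u v"
  let ?P = "\<lambda>x y. \<zeta> x < \<zeta> y \<and> ?r x > ?r y \<longrightarrow> w (\<zeta> x) > w (\<zeta> y)"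
  note zp = grassmannian_permutes[OF z]
  have l: "?r i = u i" if "i \<in> {1..p}" for i
    using that by (simp add: perm_times_def)
  have r: "?r (j + p) = v j + p" if "j \<in> {1..q}" for j
    using that by (simp add: perm_times_def)
  have lb: "u i \<le> p" if "i \<in> {1..p}" for i
    using that permutes_in_image[OF u] by (meson atLeastAtMost_iff)
  have rb: "v j > 0" if "j \<in> {1..q}" for j
    using that permutes_in_image[OF v, of j] by simp
  have lm: "\<zeta> i < \<zeta> j \<longleftrightarrow> i < j" if "i \<in> {1..p}" "j \<in> {1..p}" for i j
    using strict_mono_on_less[OF grassmannian_strict_mono_on(1)[OF z] that] .
  have rm: "\<zeta> (i + p) < \<zeta> (j + p) \<longleftrightarrow> i < j" if "i \<in> {1..q}" "j \<in> {1..q}" for i j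
    using strict_mono_on_less[OF grassmannian_strict_mono_on(2)[OF z], of "i + p" "j + p"] that
    by auto
  have "weak_le (p + q) (rho p \<zeta> u v) w \<longleftrightarrow> (\<forall>x \<in> {1..p + q}. \<forall>y \<in> {1..p + q}. ?P x y)"
    unfolding rho_def
    by (rule weak_le_comp_inv_iff[OF perm_times_permutes[OF u v] zp w])
  also have "\<dots> \<longleftrightarrow> (\<forall>i \<in> {1..p}. \<forall>j \<in> {1..p}. ?P i j) \<and>
      (\<forall>j \<in> {1..q}. \<forall>i \<in> {1..p}. ?P (j + p) i) \<and>
      (\<forall>i \<in> {1..p}. \<forall>j \<in> {1..q}. ?P i (j + p)) \<and>
      (\<forall>i \<in> {1..q}. \<forall>j \<in> {1..q}. ?P (i + p) (j + p))"
    by (simp only: ball_blocks ball_conj_distrib conj_assoc)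
  \<comment> \<open>Vacuous: letters of the left block are at most \<open>p\<close>, those of the
    right block exceed \<open>p\<close>.\<close>
  also have "(\<forall>i \<in> {1..p}. \<forall>j \<in> {1..q}. ?P i (j + p)) \<longleftrightarrow> True"
    using lb by (fastforce simp: l r)
  \<comment> \<open>The premise comparing the letters always holds here, so no trace of
    \<open>u\<close> and \<open>v\<close> remains.\<close>
  also have "(\<forall>j \<in> {1..q}. \<forall>i \<in> {1..p}. ?P (j + p) i) \<longleftrightarrow> inv_below p q \<zeta> w"
  proof -
    have "?r (j + p) > ?r i" if "j \<in> {1..q}" "i \<in> {1..p}" for i j
      using lb[OF that(2)] rb[OF that(1)] that by (simp add: l r)
    then show ?thesis unfolding inv_below_def by blast
  qed
  also have "(\<forall>i \<in> {1..p}. \<forall>j \<in> {1..p}. ?P i j) \<longleftrightarrow> weak_le p u (left_block p \<zeta> w)"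
    unfolding left_block_def weak_le_standardize_iff[OF u inj_on_blocks(1)[OF zp w]]
    by (intro ball_cong refl) (simp add: l lm)
  also have "(\<forall>i \<in> {1..q}. \<forall>j \<in> {1..q}. ?P (i + p) (j + p)) \<longleftrightarrow>
      weak_le q v (right_block p q \<zeta> w)"
    unfolding right_block_def weak_le_standardize_iff[OF v inj_on_blocks(2)[OF zp w]]
    by (intro ball_cong refl) (simp add: r rm)
  finally show ?thesis by blast
qed

text \<open>For fixed \<open>\<zeta>\<close>, the pairs with \<open>rho\<close> below
  \<open>w\<close> either do not exist or are exactly those below the pair of blocks of
  \<open>w \<circ> \<zeta>\<close>. A maximal such pair is therefore that pair of blocks.\<close>

lemma alpha_eq:
  assumes w: "w permutes {1..p + q}" and u: "u permutes {1..p}" and v: "v permutes {1..q}"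
  shows "alpha p q u v w = card {\<zeta> \<in> grassmannian p q.
    inv_below p q \<zeta> w \<and> u = left_block p \<zeta> w \<and> v = right_block p q \<zeta> w}"
  unfolding alpha_def
proof (rule arg_cong[where f = card], rule Collect_cong, rule conj_cong[OF refl])
  fix \<zeta> assume z: "\<zeta> \<in> grassmannian p q"
  let ?a = "left_block p \<zeta> w" and ?b = "right_block p q \<zeta> w"
  note ab = blocks_permute[OF z w]
  note iff = weak_le_rho_iff[OF z w]
  show "(weak_le (p + q) (rho p \<zeta> u v) w \<and>
     (\<forall>u' v'. u' permutes {1..p} \<and> v' permutes {1..q} \<and> weak_le p u u' \<and> weak_le q v v' \<and>
        weak_le (p + q) (rho p \<zeta> u' v') w \<longrightarrow> u' = u \<and> v' = v)) \<longleftrightarrow>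
     inv_below p q \<zeta> w \<and> u = ?a \<and> v = ?b" (is "?L \<and> ?M \<longleftrightarrow> ?R")
  proof
    assume LM: "?L \<and> ?M"
    then have L: "inv_below p q \<zeta> w" "weak_le p u ?a" "weak_le q v ?b"
      using iff[OF u v] by auto
    \<comment> \<open>The pair of blocks itself competes with \<open>(u, v)\<close> and lies above
      it, so maximality forces equality.\<close>
    then have "weak_le (p + q) (rho p \<zeta> ?a ?b) w"
      using iff[OF ab] ab by (simp add: weak_le_refl)
    then show ?R using LM L ab by metis
  next
    assume R: ?R
    then have ?L using iff[OF u v] u v by (simp add: weak_le_refl)
    moreover have ?M
    proof (intro allI impI)
      fix u' v'
      assume *: "u' permutes {1..p} \<and> v' permutes {1..q} \<and> weak_le p u u' \<and> weak_le q v v' \<and>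
        weak_le (p + q) (rho p \<zeta> u' v') w"
      then have "weak_le p u' u" "weak_le q v' v" using iff[of u' v'] R by auto
      then show "u' = u \<and> v' = v" using * weak_le_antisym by blast
    qed
    ultimately show "?L \<and> ?M" by blast
  qed
qed


section \<open>Bilinearity and the product formula\<close>

text \<open>Indices outside the supports contribute zero. Enlarging the supports puts
  \<open>x\<close>, \<open>y\<close> and \<open>x + y\<close> on one index set, although
  cancellation may shrink the support of the sum.\<close>

lemma ssym_mult_eq_sum_superset:
  assumes "finite A" "finite B" "Poly_Mapping.keys x \<subseteq> A" "Poly_Mapping.keys y \<subseteq> B"
  shows "x \<star> y = (\<Sum>a \<in> A. \<Sum>b \<in> B.
    (Poly_Mapping.lookup x a * Poly_Mapping.lookup y b) *\<^sub>Q fund_prod a b)"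
proof -
  have "x \<star> y = (\<Sum>a \<in> Poly_Mapping.keys x. \<Sum>b \<in> B.
    (Poly_Mapping.lookup x a * Poly_Mapping.lookup y b) *\<^sub>Q fund_prod a b)"
    unfolding ssym_mult_def using assms
    by (intro sum.cong refl sum.mono_neutral_left) (auto simp: in_keys_iff)
  also have "\<dots> = (\<Sum>a \<in> A. \<Sum>b \<in> B.
    (Poly_Mapping.lookup x a * Poly_Mapping.lookup y b) *\<^sub>Q fund_prod a b)"
    using assms by (intro sum.mono_neutral_left) (auto simp: in_keys_iff)
  finally show ?thesis .
qed

lemma ssym_mult_add_left: "(x + y) \<star> z = x \<star> z + y \<star> z"
proof -
  let ?A = "Poly_Mapping.keys x \<union> Poly_Mapping.keys y \<union> Poly_Mapping.keys (x + y)"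
  have "t \<star> z = (\<Sum>a \<in> ?A. \<Sum>b \<in> Poly_Mapping.keys z.
      (Poly_Mapping.lookup t a * Poly_Mapping.lookup z b) *\<^sub>Q fund_prod a b)"
    if "t \<in> {x, y, x + y}" for t
    using that by (intro ssym_mult_eq_sum_superset) auto
  then show ?thesis
    by (simp add: lookup_add distrib_right ssym.scale_left_distrib sum.distrib)
qed

lemma ssym_mult_add_right: "z \<star> (x + y) = z \<star> x + z \<star> y"
proof -
  let ?A = "Poly_Mapping.keys x \<union> Poly_Mapping.keys y \<union> Poly_Mapping.keys (x + y)"
  have "z \<star> t = (\<Sum>a \<in> Poly_Mapping.keys z. \<Sum>b \<in> ?A.
      (Poly_Mapping.lookup z a * Poly_Mapping.lookup t b) *\<^sub>Q fund_prod a b)"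
    if "t \<in> {x, y, x + y}" for t
    using that by (intro ssym_mult_eq_sum_superset) auto
  then show ?thesis
    by (simp add: lookup_add distrib_left ssym.scale_left_distrib sum.distrib)
qed

lemma keys_ssym_scale_subset: "Poly_Mapping.keys (c *\<^sub>Q x) \<subseteq> Poly_Mapping.keys x"
  by (auto simp: in_keys_iff)

lemma ssym_mult_scale_left: "(c *\<^sub>Q x) \<star> z = c *\<^sub>Q (x \<star> z)"
  using ssym_mult_eq_sum_superset[OF _ _ keys_ssym_scale_subset[of c x] subset_refl[of "Poly_Mapping.keys z"]]
  by (simp add: ssym_mult_def[of x z] ssym.scale_sum_right mult.assoc)

lemma ssym_mult_scale_right: "z \<star> (c *\<^sub>Q x) = c *\<^sub>Q (z \<star> x)"
  using ssym_mult_eq_sum_superset[OF _ _ subset_refl[of "Poly_Mapping.keys z"] keys_ssym_scale_subset[of c x]]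
  by (simp add: ssym_mult_def[of z x] ssym.scale_sum_right mult.left_commute)

lemma ssym_mult_zero [simp]: "0 \<star> z = 0" "z \<star> 0 = 0"
  by (simp_all add: ssym_mult_def)

lemma ssym_mult_sum_left: "(\<Sum>i \<in> A. f i) \<star> z = (\<Sum>i \<in> A. f i \<star> z)"
  by (induction A rule: infinite_finite_induct) (simp_all add: ssym_mult_add_left)

lemma ssym_mult_sum_right: "z \<star> (\<Sum>i \<in> A. f i) = (\<Sum>i \<in> A. z \<star> f i)"
  by (induction A rule: infinite_finite_induct) (simp_all add: ssym_mult_add_right)

text \<open>By \<open>weak_le_rho_iff\<close> the indicator of \<open>rho\<close> being below
  \<open>w\<close> factors into three, with \<open>u\<close> and \<open>v\<close> in separate
  factors; the two Moebius sums can then be evaluated independently.\<close>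

lemma fund_mult_fund_eq_sum_mon:
  assumes u: "u permutes {1..p}" and v: "v permutes {1..q}"
  shows "\<F> p u \<star> \<F> q v = (\<Sum>w \<in> {w. w permutes {1..p + q}}. \<Sum>\<zeta> \<in> grassmannian p q.
    (of_bool (inv_below p q \<zeta> w) * of_bool (weak_le p u (left_block p \<zeta> w)) *
      of_bool (weak_le q v (right_block p q \<zeta> w))) *\<^sub>Q \<M> (p + q) w)"
proof -
  let ?W = "{w. w permutes {1..p + q}}"
  have "\<F> p u \<star> \<F> q v = (\<Sum>\<zeta> \<in> grassmannian p q. \<F> (p + q) (rho p \<zeta> u v))"
    using fund_mult_fund[OF u v] by (simp add: rho_def)
  also have "\<dots> = (\<Sum>\<zeta> \<in> grassmannian p q. \<Sum>w \<in> ?W.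
    (of_bool (inv_below p q \<zeta> w) * of_bool (weak_le p u (left_block p \<zeta> w)) *
      of_bool (weak_le q v (right_block p q \<zeta> w))) *\<^sub>Q \<M> (p + q) w)"
  proof (rule sum.cong[OF refl])
    fix \<zeta> assume z: "\<zeta> \<in> grassmannian p q"
    have "\<F> (p + q) (rho p \<zeta> u v) = (\<Sum>w \<in> {w. weak_le (p + q) (rho p \<zeta> u v) w}. \<M> (p + q) w)"
      by (rule fund_eq_sum_mon[OF rho_permutes[OF z u v]])
    also have "\<dots> = (\<Sum>w \<in> ?W. of_bool (weak_le (p + q) (rho p \<zeta> u v) w) *\<^sub>Q \<M> (p + q) w)"
      by (intro sum.mono_neutral_cong_left) (auto simp: weak_le_def finite_permutations)
    also have "\<dots> = (\<Sum>w \<in> ?W. (of_bool (inv_below p q \<zeta> w) *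
        of_bool (weak_le p u (left_block p \<zeta> w)) *
        of_bool (weak_le q v (right_block p q \<zeta> w))) *\<^sub>Q \<M> (p + q) w)"
      by (intro sum.cong refl) (simp add: weak_le_rho_iff[OF z _ u v] of_bool_conj mult.assoc)
    finally show "\<F> (p + q) (rho p \<zeta> u v) = \<dots>" .
  qed
  finally show ?thesis by (subst sum.swap)
qed

theorem theorem2p2:
  fixes p q :: nat and u v :: "nat \<Rightarrow> nat"
  assumes "u permutes {1..p}" and "v permutes {1..q}"
  shows "\<M> p u \<star> \<M> q v =
    (\<Sum>w \<in> {w. w permutes {1..p + q}}. of_nat (alpha p q u v w) *\<^sub>Q \<M> (p + q) w)"
proof -
  let ?W = "{w. w permutes {1..p + q}}" and ?G = "grassmannian p q"
  let ?U = "{u'. weak_le p u u'}" and ?V = "{v'. weak_le q v v'}"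
  define c :: "(nat \<Rightarrow> nat) \<Rightarrow> rat" where "c u' = of_int (moebius p u u')" for u'
  define d :: "(nat \<Rightarrow> nat) \<Rightarrow> rat" where "d v' = of_int (moebius q v v')" for v'
  let ?i = "\<lambda>\<zeta> w. of_bool (inv_below p q \<zeta> w) :: rat"
  let ?l = "\<lambda>u' \<zeta> w. of_bool (weak_le p u' (left_block p \<zeta> w)) :: rat"
  let ?r = "\<lambda>v' \<zeta> w. of_bool (weak_le q v' (right_block p q \<zeta> w)) :: rat"
  \<comment> \<open>This is the coefficient of \<open>\<M> (p + q) w\<close> once the sums are
    reordered. By \<open>sum_moebius\<close> each inner sum becomes the indicator that
    \<open>u\<close>, respectively \<open>v\<close>, equals its block, and \<open>alpha_eq\<close>
    counts the surviving \<zeta>.\<close>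
  have coeff: "(\<Sum>\<zeta> \<in> ?G. ?i \<zeta> w * (\<Sum>u' \<in> ?U. c u' * ?l u' \<zeta> w) * (\<Sum>v' \<in> ?V. d v' * ?r v' \<zeta> w)) =
      of_nat (alpha p q u v w)" if w: "w \<in> ?W" for w
  proof -
    have "(\<Sum>\<zeta> \<in> ?G. ?i \<zeta> w * (\<Sum>u' \<in> ?U. c u' * ?l u' \<zeta> w) * (\<Sum>v' \<in> ?V. d v' * ?r v' \<zeta> w)) =
        (\<Sum>\<zeta> \<in> ?G. of_bool (inv_below p q \<zeta> w \<and> u = left_block p \<zeta> w \<and> v = right_block p q \<zeta> w))"
    proof (rule sum.cong[OF refl])
      fix \<zeta> assume "\<zeta> \<in> ?G"
      then have ab: "left_block p \<zeta> w permutes {1..p}" "right_block p q \<zeta> w permutes {1..q}"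
        using blocks_permute w by auto
      have "(\<Sum>u' \<in> ?U. c u' * ?l u' \<zeta> w) = of_bool (u = left_block p \<zeta> w)"
        using arg_cong[OF sum_moebius[OF assms(1) ab(1)], of "of_int :: int \<Rightarrow> rat"]
        by (simp add: c_def)
      moreover have "(\<Sum>v' \<in> ?V. d v' * ?r v' \<zeta> w) = of_bool (v = right_block p q \<zeta> w)"
        using arg_cong[OF sum_moebius[OF assms(2) ab(2)], of "of_int :: int \<Rightarrow> rat"]
        by (simp add: d_def)
      ultimately show "?i \<zeta> w * (\<Sum>u' \<in> ?U. c u' * ?l u' \<zeta> w) * (\<Sum>v' \<in> ?V. d v' * ?r v' \<zeta> w) =
          of_bool (inv_below p q \<zeta> w \<and> u = left_block p \<zeta> w \<and> v = right_block p q \<zeta> w)"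
        by (simp add: of_bool_conj)
    qed
    also have "\<dots> = of_nat (alpha p q u v w)"
      using w assms by (simp add: alpha_eq Int_def)
    finally show ?thesis .
  qed
  have "\<M> p u \<star> \<M> q v = (\<Sum>u' \<in> ?U. \<Sum>v' \<in> ?V. (c u' * d v') *\<^sub>Q (\<F> p u' \<star> \<F> q v'))"
    unfolding mon_def ssym_mult_sum_left
    by (simp add: c_def d_def ssym_mult_sum_right ssym_mult_scale_left ssym_mult_scale_right
        ssym.scale_sum_right mult.commute[of "of_int (moebius q v _)"])
  \<comment> \<open>Each Moebius coefficient is grouped with the indicator in the same variable, in
    preparation for factoring.\<close>
  also have "\<dots> = (\<Sum>u' \<in> ?U. \<Sum>v' \<in> ?V. \<Sum>w \<in> ?W. \<Sum>\<zeta> \<in> ?G.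
      (?i \<zeta> w * (c u' * ?l u' \<zeta> w) * (d v' * ?r v' \<zeta> w)) *\<^sub>Q \<M> (p + q) w)"
    by (intro sum.cong refl, subst fund_mult_fund_eq_sum_mon)
      (auto simp: weak_le_def ssym.scale_sum_right mult_ac)
  also have "\<dots> = (\<Sum>w \<in> ?W. \<Sum>u' \<in> ?U. \<Sum>v' \<in> ?V. \<Sum>\<zeta> \<in> ?G.
      (?i \<zeta> w * (c u' * ?l u' \<zeta> w) * (d v' * ?r v' \<zeta> w)) *\<^sub>Q \<M> (p + q) w)"
    by (simp only: sum.swap[of _ ?W ?V] sum.swap[of _ ?W ?U])
  \<comment> \<open>The sum over \<open>?U\<close> goes innermost, matching the order in which the
    product of sums in the next line expands.\<close>
  also have "\<dots> = (\<Sum>w \<in> ?W. \<Sum>\<zeta> \<in> ?G. \<Sum>v' \<in> ?V. \<Sum>u' \<in> ?U.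
      (?i \<zeta> w * (c u' * ?l u' \<zeta> w) * (d v' * ?r v' \<zeta> w)) *\<^sub>Q \<M> (p + q) w)"
    by (simp only: sum.swap[of _ ?G ?V] sum.swap[of _ ?G ?U] sum.swap[of _ ?V ?U])
  also have "\<dots> = (\<Sum>w \<in> ?W. (\<Sum>\<zeta> \<in> ?G. ?i \<zeta> w * (\<Sum>u' \<in> ?U. c u' * ?l u' \<zeta> w) *
      (\<Sum>v' \<in> ?V. d v' * ?r v' \<zeta> w)) *\<^sub>Q \<M> (p + q) w)"
    by (simp only: ssym.scale_sum_left sum_distrib_left sum_distrib_right)
  also have "\<dots> = (\<Sum>w \<in> ?W. of_nat (alpha p q u v w) *\<^sub>Q \<M> (p + q) w)"
    by (intro sum.cong refl) (simp only: coeff)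
  finally show ?thesis .
qed

end
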